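(* Let $D$ be an integrally closed AGCD domain. Then $D$ is completely integrally closed if and only if $D$ is Archimedean.
   Context: $D$ is an integral domain with quotient field $K$. $D$ is an almost GCD (AGCD) domain if for all nonzero $a,b\in D$ there is an integer $n\ge1$ such that $(a^n)\cap(b^n)$ is principal. $D$ is completely integrally closed if whenever $x\in K$ and $0\ne r\in D$ satisfy $rx^n\in D$ for every integer $n\ge1$, then $x\in D$. $D$ is Archimedean if $\bigcap_{n=1}^{\infty}(x^n)=(0)$ for every nonunit $x\in D$. *)

theory Defs
  imports "HOL-Computational_Algebra.Polynomial_Factorial"
begin

text \<open>
  The integral domain \<open>D\<close> is a type \<open>'a\<close> of class \<^class>\<open>idom\<close>, and its quotient field \<open>K\<close> is
  \<^typ>\<open>'a fract\<close>, with \<open>D\<close> embedded as the range of \<^const>\<open>to_fract\<close>. Properties of \<open>D\<close>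
  itself are predicates on \<^term>\<open>TYPE('a::idom)\<close>.
\<close>

definition pideal :: "'a::idom \<Rightarrow> 'a set" where
  "pideal a = {r * a |r. True}"

definition principal :: "'a::idom set \<Rightarrow> bool" where
  "principal I \<longleftrightarrow> (\<exists>c. I = pideal c)"

definition AGCD_domain :: "'a::idom itself \<Rightarrow> bool" where
  "AGCD_domain _ \<longleftrightarrow>
     (\<forall>a b :: 'a. a \<noteq> 0 \<longrightarrow> b \<noteq> 0 \<longrightarrow> (\<exists>n\<ge>1. principal (pideal (a ^ n) \<inter> pideal (b ^ n))))"

definition integral_elem :: "'a::idom fract \<Rightarrow> bool" where
  "integral_elem x \<longleftrightarrow> (\<exists>p :: 'a poly. lead_coeff p = 1 \<and> poly (map_poly to_fract p) x = 0)"

definition integrally_closed :: "'a::idom itself \<Rightarrow> bool" where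
  "integrally_closed _ \<longleftrightarrow> (\<forall>x :: 'a fract. integral_elem x \<longrightarrow> x \<in> range to_fract)"

definition completely_integrally_closed :: "'a::idom itself \<Rightarrow> bool" where
  "completely_integrally_closed _ \<longleftrightarrow>
     (\<forall>(x :: 'a fract) (r :: 'a).
        r \<noteq> 0 \<longrightarrow> (\<forall>n\<ge>1. to_fract r * x ^ n \<in> range to_fract) \<longrightarrow> x \<in> range to_fract)"

definition archimedean_domain :: "'a::idom itself \<Rightarrow> bool" where
  "archimedean_domain _ \<longleftrightarrow>
     (\<forall>x :: 'a. \<not> x dvd 1 \<longrightarrow> (\<Inter>n\<in>{1..}. pideal (x ^ n)) = {0})"

end

theory Submission
  imports Defs
begin

text \<open>
  Let \<open>x = a / b\<close> and \<open>(a ^ N) \<inter> (b ^ N) = (c)\<close> with \<open>c = a ^ N u = b ^ N v\<close>. Then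
  \<open>x ^ N = v / u\<close>, and minimality of \<open>c\<close> makes \<open>u\<close> coprime to \<open>v\<close> in the strong sense that
  \<open>u\<close> divides \<open>w\<close> whenever it divides \<open>v w\<close>. If \<open>r x ^ n\<close> lies in \<open>D\<close> for all \<open>n\<close>, then
  \<open>u ^ n\<close> divides \<open>v ^ n r\<close>, hence \<open>r\<close>, for all \<open>n\<close>, so the Archimedean property makes \<open>u\<close>
  a unit; thus \<open>x ^ N\<close> lies in \<open>D\<close>, and \<open>x\<close> does so by integral closedness.
  Conversely, a nonzero \<open>r\<close> divisible by all powers of \<open>x\<close> is a common denominator of the powers
  of \<open>1 / x\<close>.
\<close>

lemma mem_pideal_iff: "y \<in> pideal a \<longleftrightarrow> a dvd y"
  by (auto simp: pideal_def dvd_def mult.commute)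

lemma to_fract_power: "to_fract (x ^ n) = to_fract x ^ n"
  by (induction n) simp_all

lemma to_fract_divide_in_range_iff:
  assumes "b \<noteq> 0"
  shows "to_fract a / to_fract b \<in> range to_fract \<longleftrightarrow> b dvd a"
proof -
  have "to_fract a / to_fract b = to_fract q \<longleftrightarrow> a = b * q" for q
    using assms by (simp add: field_simps flip: to_fract_mult)
  then show ?thesis by (auto simp: dvd_def image_iff)
qed

lemma fract_quotient_cases:
  obtains a b where "b \<noteq> 0" "x = to_fract a / to_fract b"
  by (cases x) (metis Fract_conv_to_fract)

lemma to_fract_mult_power_in_range_iff:
  assumes "b \<noteq> 0"
  shows "to_fract r * (to_fract a / to_fract b) ^ n \<in> range to_fract \<longleftrightarrow> b ^ n dvd a ^ n * r"
  using to_fract_divide_in_range_iff[of "b ^ n" "a ^ n * r"] assms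
  by (simp add: to_fract_power power_divide mult.commute)

text \<open>Without gcds in \<open>D\<close>, coprimality is expressed by Euclid's lemma for
  \<open>u\<close> and \<open>v\<close>. Induction on \<open>n\<close> handles one factor
  \<open>v\<close>; induction on \<open>m\<close> then strips the factors \<open>v\<close> one by
  one.\<close>

lemma power_dvd_mult_power_imp_dvd:
  fixes u v :: "'a::idom"
  assumes "u \<noteq> 0" and coprime: "\<And>w. u dvd v * w \<Longrightarrow> u dvd w"
  shows "u ^ n dvd v ^ m * w \<Longrightarrow> u ^ n dvd w"
proof -
  have single: "u ^ n dvd v * w \<Longrightarrow> u ^ n dvd w" for n w
  proof (induction n arbitrary: w)
    case (Suc n)
    then have "u dvd v * w"
      by (metis dvd_mult_left power_Suc)
    then have "u dvd w"
      by (rule coprime)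
    then obtain w' where w': "w = u * w'" ..
    \<comment> \<open>One factor \<open>u\<close> is cancelled from
      \<open>u ^ Suc n dvd v * (u * w')\<close>.\<close>
    with Suc.prems \<open>u \<noteq> 0\<close> have "u ^ n dvd v * w'"
      by (simp add: mult.left_commute)
    then have "u ^ n dvd w'"
      by (rule Suc.IH)
    then show ?case
      by (simp add: w' mult_dvd_mono)
  qed simp
  show "u ^ n dvd v ^ m * w \<Longrightarrow> u ^ n dvd w"
  proof (induction m)
    case (Suc m)
    then have "u ^ n dvd v * (v ^ m * w)"
      by (simp add: mult.assoc)
    then show ?case
      using single Suc.IH by blast
  qed simp
qed

text \<open>If \<open>x ^ n\<close> is the image of \<open>t\<close>, then \<open>x\<close> is a
  root of the monic polynomial \<open>X ^ n - t\<close>.\<close>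

lemma power_in_range_to_fract_imp:
  fixes x :: "'a::idom fract"
  assumes "integrally_closed TYPE('a)" and "n \<ge> 1" and "x ^ n \<in> range to_fract"
  shows "x \<in> range to_fract"
proof -
  obtain t :: 'a where t: "x ^ n = to_fract t"
    using assms by blast
  let ?p = "monom 1 n + [:- t:]"
  \<comment> \<open>Since \<open>n \<ge> 1\<close>, the constant term \<open>- t\<close> does not
    disturb the leading coefficient.\<close>
  have deg: "degree ?p = n"
    using \<open>n \<ge> 1\<close> by (simp add: degree_add_eq_left degree_monom_eq)
  then have "lead_coeff ?p = 1"
    using \<open>n \<ge> 1\<close> by (simp add: coeff_pCons split: nat.split)
  moreover have "map_poly to_fract ?p = monom 1 n + [:- to_fract t:]"
    by (rule poly_eqI) (simp add: coeff_map_poly coeff_pCons split: nat.split)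
  then have "poly (map_poly to_fract ?p) x = 0"
    by (simp add: poly_monom t)
  ultimately show ?thesis
    using assms(1) unfolding integrally_closed_def integral_elem_def by blast
qed

text \<open>A generator \<open>c\<close> of the intersection is a least common multiple of
  \<open>a ^ n\<close> and \<open>b ^ n\<close>, and \<open>u\<close>, \<open>v\<close> are its
  cofactors. A common factor of these would contradict minimality.\<close>

lemma AGCD_domain_power_quotient:
  fixes a b :: "'a::idom"
  assumes "AGCD_domain TYPE('a)" "a \<noteq> 0" "b \<noteq> 0"
  obtains n u v where "n \<ge> 1" "u \<noteq> 0" "a ^ n * u = b ^ n * v"
    "\<And>w. u dvd v * w \<Longrightarrow> u dvd w"
proof -
  obtain n c where "n \<ge> 1" and c: "pideal (a ^ n) \<inter> pideal (b ^ n) = pideal c"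
    using assms unfolding AGCD_domain_def principal_def by blast
  have c_dvd_iff: "c dvd y \<longleftrightarrow> a ^ n dvd y \<and> b ^ n dvd y" for y
    using c by (metis IntE IntI mem_pideal_iff)
  from c_dvd_iff[of c] obtain u v where u: "c = a ^ n * u" and v: "c = b ^ n * v"
    by (metis dvd_def dvd_refl)
  have "c dvd a ^ n * b ^ n"
    by (simp add: c_dvd_iff)
  then have "u \<noteq> 0"
    using u assms by auto
  have coprime: "u dvd w" if "u dvd v * w" for w
  proof -
    obtain s where s: "v * w = u * s"
      using \<open>u dvd v * w\<close> by (auto simp: dvd_def)
    \<comment> \<open>Both sides equal \<open>c * w\<close>. Cancelling \<open>u\<close> shows that
      \<open>a ^ n * w\<close> is a common multiple, so \<open>c = a ^ n * u\<close> divides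
      it.\<close>
    have "u * (a ^ n * w) = u * (b ^ n * s)"
      using u v s by (metis mult.assoc mult.commute)
    then have "c dvd a ^ n * w"
      using \<open>u \<noteq> 0\<close> by (metis c_dvd_iff dvd_triv_left mult_left_cancel)
    then show ?thesis
      using u \<open>a \<noteq> 0\<close> by simp
  qed
  have "a ^ n * u = b ^ n * v"
    using u v by simp
  from that[OF \<open>n \<ge> 1\<close> \<open>u \<noteq> 0\<close> this coprime] show thesis .
qed

text \<open>The intersection always contains 0, so it is \<open>{0}\<close> exactly when it has no
  nonzero element; the rest is contraposition.\<close>

lemma archimedean_domain_iff:
  "archimedean_domain TYPE('a::idom) \<longleftrightarrow>
    (\<forall>x r :: 'a. r \<noteq> 0 \<longrightarrow> (\<forall>n\<ge>1. x ^ n dvd r) \<longrightarrow> x dvd 1)"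
proof -
  have "(\<Inter>n\<in>{1..}. pideal (x ^ n)) = {0} \<longleftrightarrow> (\<forall>r. r \<noteq> 0 \<longrightarrow> \<not> (\<forall>n\<ge>1. x ^ n dvd r))"
    (is "?I = _ \<longleftrightarrow> _") for x :: 'a
  proof -
    have mem: "r \<in> ?I \<longleftrightarrow> (\<forall>n\<ge>1. x ^ n dvd r)" for r
      by (auto simp: mem_pideal_iff)
    then have "0 \<in> ?I"
      by simp
    then have "?I = {0} \<longleftrightarrow> (\<forall>r. r \<noteq> 0 \<longrightarrow> r \<notin> ?I)"
      by blast
    then show ?thesis
      unfolding mem .
  qed
  then show ?thesis
    unfolding archimedean_domain_def by (simp only:) blast
qed

lemma completely_integrally_closed_imp_archimedean:
  assumes "completely_integrally_closed TYPE('a::idom)"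
  shows "archimedean_domain TYPE('a)"
  unfolding archimedean_domain_iff
proof (intro allI impI)
  fix x r :: 'a
  assume "r \<noteq> 0" and dvd: "\<forall>n\<ge>1. x ^ n dvd r"
  then have "x \<noteq> 0"
    by (metis dvd_0_left_iff le_refl power_one_right)
  then have "\<forall>n\<ge>1. to_fract r * (to_fract 1 / to_fract x) ^ n \<in> range to_fract"
    using dvd by (subst to_fract_mult_power_in_range_iff) simp_all
  with assms \<open>r \<noteq> 0\<close> have "to_fract 1 / to_fract x \<in> range to_fract"
    unfolding completely_integrally_closed_def by blast
  then show "x dvd 1"
    using \<open>x \<noteq> 0\<close> to_fract_divide_in_range_iff by blast
qed

lemma archimedean_imp_completely_integrally_closed:
  assumes closed: "integrally_closed TYPE('a::idom)" and agcd: "AGCD_domain TYPE('a)"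
    and arch: "archimedean_domain TYPE('a)"
  shows "completely_integrally_closed TYPE('a)"
  unfolding completely_integrally_closed_def
proof (intro allI impI)
  fix x :: "'a fract" and r :: 'a
  assume "r \<noteq> 0" and r: "\<forall>n\<ge>1. to_fract r * x ^ n \<in> range to_fract"
  obtain a b where "b \<noteq> 0" and x: "x = to_fract a / to_fract b"
    by (rule fract_quotient_cases)
  show "x \<in> range to_fract"
  \<comment> \<open>The AGCD property speaks only of nonzero elements.\<close>
  proof (cases "a = 0")
    case True
    then show ?thesis
      unfolding x to_fract_divide_in_range_iff[OF \<open>b \<noteq> 0\<close>] by simp
  next
    case False
    obtain N u v where "N \<ge> 1" "u \<noteq> 0" and eq: "a ^ N * u = b ^ N * v"
      and coprime: "\<And>w. u dvd v * w \<Longrightarrow> u dvd w"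
      using AGCD_domain_power_quotient[OF agcd False \<open>b \<noteq> 0\<close>] by metis
    have "to_fract a ^ N * to_fract u = to_fract b ^ N * to_fract v"
      using eq by (simp flip: to_fract_power to_fract_mult)
    then have xN: "x ^ N = to_fract v / to_fract u"
      using \<open>b \<noteq> 0\<close> \<open>u \<noteq> 0\<close> by (simp add: x power_divide frac_eq_eq mult.commute)
    have "u ^ n dvd r" if "n \<ge> 1" for n
    proof -
      \<comment> \<open>This is the hypothesis on \<open>r\<close> at the exponent
        \<open>N * n\<close>.\<close>
      have "to_fract r * (x ^ N) ^ n \<in> range to_fract"
        using r \<open>N \<ge> 1\<close> \<open>n \<ge> 1\<close> by (simp flip: power_mult)
      then have "u ^ n dvd v ^ n * r"
        unfolding xN to_fract_mult_power_in_range_iff[OF \<open>u \<noteq> 0\<close>] .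
      then show ?thesis
        using power_dvd_mult_power_imp_dvd[OF \<open>u \<noteq> 0\<close>] coprime by blast
    qed
    then have "u dvd 1"
      using arch \<open>r \<noteq> 0\<close> unfolding archimedean_domain_iff by blast
    then have "u dvd v"
      using dvd_trans one_dvd by blast
    then have "x ^ N \<in> range to_fract"
      unfolding xN to_fract_divide_in_range_iff[OF \<open>u \<noteq> 0\<close>] .
    then show ?thesis
      by (rule power_in_range_to_fract_imp[OF closed \<open>N \<ge> 1\<close>])
  qed
qed

theorem corollary2p12:
  assumes "integrally_closed TYPE('a::idom)"
    and "AGCD_domain TYPE('a)"
  shows "completely_integrally_closed TYPE('a) \<longleftrightarrow> archimedean_domain TYPE('a)"
  using completely_integrally_closed_imp_archimedean
    archimedean_imp_completely_integrally_closed[OF assms] by blast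

end
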